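(* Let $n\ge 1$ and $k\ge 0$ be integers, let $m\in\{0,1\}$, and put $r=n+k+m$ and $s=n-k+m$. Let $a(r,s)$ denote the coefficient of $x^s$ in the Chebyshev polynomial of degree $r$, of the second kind $U_r$ if $m=0$ and of the first kind $T_r$ if $m=1$ (with coefficient $0$ if $s<0$). Then $$(-1)^k a(r,s)=\sum_{i=0}^{n}(-1)^i\binom{n}{i}\binom{2n+m-2i}{n+k}.$$
   Context: The Chebyshev polynomials of the first kind are $T_0=1$, $T_1=x$, $T_{r+1}=2xT_r-T_{r-1}$; those of the second kind are $U_0=1$, $U_1=2x$, $U_{r+1}=2xU_r-U_{r-1}$. *)

theory Defs
  imports "HOL-Computational_Algebra.Polynomial"
begin

fun cheb_T :: "nat \<Rightarrow> int poly" where
  "cheb_T 0 = 1"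
| "cheb_T (Suc 0) = [:0, 1:]"
| "cheb_T (Suc (Suc r)) = 2 * [:0, 1:] * cheb_T (Suc r) - cheb_T r"

fun cheb_U :: "nat \<Rightarrow> int poly" where
  "cheb_U 0 = 1"
| "cheb_U (Suc 0) = 2 * [:0, 1:]"
| "cheb_U (Suc (Suc r)) = 2 * [:0, 1:] * cheb_U (Suc r) - cheb_U r"

text \<open>The exponent \<open>s\<close> is an integer because it may be negative; the kind \<open>m\<close> is only
  meaningful for \<open>m \<in> {0, 1}\<close>.\<close>

definition cheb_coeff :: "nat \<Rightarrow> nat \<Rightarrow> int \<Rightarrow> int" where
  "cheb_coeff m r s =
     (if s < 0 then 0 else coeff (if m = 0 then cheb_U r else cheb_T r) (nat s))"

end

theory Submission imports Defs begin

text \<open>The alternating sum is the coefficient of \<open>y ^ (n + k)\<close> in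
  \<open>(1 + y) ^ m * ((1 + y)\<^sup>2 - 1) ^ n = y ^ n * (1 + y) ^ m * (2 + y) ^ n\<close>, hence the coefficient of
  \<open>y ^ k\<close> in \<open>(1 + y) ^ m * (2 + y) ^ n\<close>. Multiplication by \<open>2 + y\<close> gives these coefficients a
  two-term recurrence in \<open>n\<close>, which is the Chebyshev recurrence in the coordinates \<open>(n, k)\<close>.\<close>

lemma coeff_linear_power_binomial:
  "coeff ([:1, 1:] ^ N :: int poly) j = int (N choose j)"
proof (induction N arbitrary: j)
  case 0
  then show ?case by (cases j) simp_all
next
  case (Suc N)
  then show ?case by (cases j) (simp_all add: coeff_pCons)
qed

lemma alternating_binomial_sum_eq_coeff:
  "(\<Sum>i=0..n. (-1) ^ i * int (n choose i) * int ((2 * n + m - 2 * i) choose (n + k))) =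
    coeff ([:1, 1:] ^ m * [:2, 1:] ^ n) k"
proof -
  have "([:1, 1:] :: int poly) ^ m * ([:1, 1:]\<^sup>2 - 1) ^ n =
    [:1, 1:] ^ m * (\<Sum>i\<le>n. of_nat (n choose i) * (-1) ^ i * ([:1, 1:]\<^sup>2) ^ (n - i))"
    using binomial_ring[of "-1" "[:1, 1:]\<^sup>2 :: int poly" n] by simp
  also have "\<dots> = (\<Sum>i=0..n. smult ((-1) ^ i * int (n choose i)) ([:1, 1:] ^ (2 * n + m - 2 * i)))"
    unfolding sum_distrib_left atLeast0AtMost
  proof (rule sum.cong[OF refl])
    fix i assume "i \<in> {..n}"
    \<comment> \<open>Subtraction here is truncated on \<open>nat\<close>; the identity relies on
      \<open>i \<le> n\<close>.\<close>
    then have "2 * n + m - 2 * i = m + 2 * (n - i)" by simp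
    moreover have "(-1 :: int poly) ^ i = [:(-1) ^ i:]"
      by (induction i) (simp_all add: one_pCons)
    ultimately show "[:1, 1:] ^ m * (of_nat (n choose i) * (-1) ^ i * ([:1, 1:]\<^sup>2) ^ (n - i)) =
        smult ((-1) ^ i * int (n choose i)) ([:1, 1:] ^ (2 * n + m - 2 * i))"
      by (simp add: power_add of_nat_poly mult.commute flip: power_mult)
  qed
  finally have expand: "([:1, 1:] :: int poly) ^ m * ([:1, 1:]\<^sup>2 - 1) ^ n = \<dots>" .
  have "([:1, 1:]\<^sup>2 - 1 :: int poly) = monom 1 1 * [:2, 1:]"
    by (simp add: power2_eq_square one_pCons monom_altdef)
  then have "([:1, 1:] :: int poly) ^ m * ([:1, 1:]\<^sup>2 - 1) ^ n =
      monom 1 n * ([:1, 1:] ^ m * [:2, 1:] ^ n)"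
    by (simp add: power_mult_distrib monom_power mult.left_commute del: mult_pCons_right)
  with expand have "coeff (monom 1 n * ([:1, 1:] ^ m * [:2, 1:] ^ n)) (n + k) =
      (\<Sum>i=0..n. (-1) ^ i * int (n choose i) * int ((2 * n + m - 2 * i) choose (n + k)))"
    by (simp add: coeff_sum coeff_linear_power_binomial)
  then show ?thesis by (simp add: coeff_monom_mult)
qed

text \<open>Both kinds share the same recurrence. The default value 0 at negative exponents lets it
  hold for every integer \<open>s\<close>: at \<open>s = 0\<close> the term with exponent
  \<open>s - 1\<close> vanishes, just as \<open>2 * x * p\<close> has no constant term.\<close>

lemma cheb_coeff_Suc_Suc:
  "cheb_coeff m (Suc (Suc r)) s = 2 * cheb_coeff m (Suc r) (s - 1) - cheb_coeff m r s"
proof -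
  have *: "coeff (2 * [:0, 1:] * p) j = (case j of 0 \<Rightarrow> 0 | Suc i \<Rightarrow> 2 * coeff p i)"
    for p :: "int poly" and j
    by (cases j) (simp_all add: numeral_poly)
  have **: "nat (int (Suc i) - 1) = i" for i by simp
  consider "s < 0" | "s = 0" | i where "s = int (Suc i)"
    by (metis linorder_not_less nonneg_int_cases not0_implies_Suc of_nat_0)
  then show ?thesis
    by cases (simp_all add: cheb_coeff_def * ** del: of_nat_Suc mult_pCons_right)
qed

text \<open>This removes the subtracted term of the recurrence along \<open>k = 0\<close>, where
  leading coefficients are computed.\<close>

lemma cheb_coeff_above_degree:
  "int r < s \<Longrightarrow> cheb_coeff m r s = 0"
proof (induction r arbitrary: s rule: induct_nat_012)
  case (ge2 r)
  then show ?case by (simp add: cheb_coeff_Suc_Suc)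
qed (auto simp: cheb_coeff_def coeff_pCons numeral_poly one_pCons split: nat.split)

text \<open>In the coordinates \<open>(n, k)\<close> the Chebyshev recurrence expresses the value at
  \<open>(n + 1, k)\<close> through those at \<open>(n, k)\<close> and \<open>(n, k - 1)\<close>, so
  induction on \<open>n\<close> with \<open>k\<close> arbitrary suffices.\<close>

lemma cheb_coeff_eq_coeff:
  assumes "m \<in> {0, 1}"
  shows "(-1) ^ k * cheb_coeff m (n + k + m) (int n - int k + int m) =
    coeff ([:1, 1:] ^ m * [:2, 1:] ^ n) k"
proof (induction n arbitrary: k)
  case 0
  \<comment> \<open>The exponent is \<open>m - k\<close>: from \<open>k = 2\<close> on it is
    negative, matching the vanishing coefficients of \<open>(1 + y) ^ m\<close>. For
    \<open>k = m = 1\<close> the entry is the constant term -1 of \<open>T_2\<close>.\<close>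
  consider "k = 0" | "k = 1" | "k \<ge> 2" by linarith
  then show ?case
    using assms by cases
      (auto simp: cheb_coeff_def coeff_pCons numeral_poly one_pCons numeral_2_eq_2 split: nat.split)
next
  case (Suc n)
  have step: "coeff ([:1, 1:] ^ m * [:2, 1:] ^ Suc n) j =
      2 * coeff ([:1, 1:] ^ m * [:2, 1:] ^ n :: int poly) j +
      (case j of 0 \<Rightarrow> 0 | Suc i \<Rightarrow> coeff ([:1, 1:] ^ m * [:2, 1:] ^ n) i)" for j
    by (cases j) (simp_all add: distrib_left)
  show ?case
  proof (cases k)
    case 0
    show ?thesis
    proof (cases "n + m")
      case 0
      \<comment> \<open>The target is \<open>U_1\<close>, an initial value that the recurrence does
        not reach.\<close>
      with \<open>k = 0\<close> show ?thesis by (simp add: cheb_coeff_def numeral_poly)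
    next
      case (Suc q)
      then have "cheb_coeff m (Suc n + m) (int (Suc n) + int m) =
          2 * cheb_coeff m (n + m) (int n + int m)"
        using cheb_coeff_Suc_Suc[of m q "int (Suc n) + int m"]
          cheb_coeff_above_degree[of q "int (Suc n) + int m" m] by simp
      then show ?thesis using \<open>k = 0\<close> Suc.IH[of 0] by (simp add: step del: power_Suc)
    qed
  next
    case (Suc j)
    have "cheb_coeff m (Suc n + k + m) (int (Suc n) - int k + int m) =
        2 * cheb_coeff m (n + k + m) (int n - int k + int m)
        - cheb_coeff m (n + j + m) (int n - int j + int m)"
      using cheb_coeff_Suc_Suc[of m "n + j + m" "int (Suc n) - int k + int m"] Suc
      by (simp add: algebra_simps)
    \<comment> \<open>Since \<open>(-1) ^ k = - (-1) ^ j\<close>, the sign factor turns the minus of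
      the recurrence into the plus of multiplication by \<open>2 + y\<close>.\<close>
    then have "(-1) ^ k * cheb_coeff m (Suc n + k + m) (int (Suc n) - int k + int m) =
        2 * ((-1) ^ k * cheb_coeff m (n + k + m) (int n - int k + int m))
        + (-1) ^ j * cheb_coeff m (n + j + m) (int n - int j + int m)"
      unfolding \<open>k = Suc j\<close> power_Suc by (simp only: right_diff_distrib)
    then show ?thesis
      unfolding Suc.IH step by (simp only: \<open>k = Suc j\<close> nat.case)
  qed
qed

theorem theorem6:
  fixes n k m r :: nat and s :: int
  assumes "n \<ge> 1" and "m \<in> {0, 1}"
    and "r = n + k + m" and "s = int n - int k + int m"
  shows "(-1) ^ k * cheb_coeff m r s =
    (\<Sum>i=0..n. (-1) ^ i * int (n choose i) * int ((2 * n + m - 2 * i) choose (n + k)))"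
  using assms cheb_coeff_eq_coeff alternating_binomial_sum_eq_coeff by simp

end
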